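(* Let $Q\in\mathbb{R}^{n\times n}$ be a symmetric matrix, $q\in\mathbb{R}^n$, and $C\subset\mathbb{R}^n$ a nonempty closed convex set. For any $x^0\in C$, $\rho>0$, and $\eta>0$, the trajectory $x(\cdot)$ of the dynamical system $$\dot{x}(t)=\frac{1}{\eta}\left[P_C\left(x(t)-\frac{1}{\rho}\big(Qx(t)+q\big)\right)-x(t)\right]\quad\text{for all } t\ge 0,\qquad x(0)=x^0,$$ is contained in $C$, that is, $x(t)\in C$ for all $t\ge 0$.
   Context: $P_C(u)$ denotes the metric (Euclidean nearest-point) projection of $u\in\mathbb{R}^n$ onto the closed convex set $C$. The trajectory is the unique $C^1$ solution of the stated initial value problem. *)

theory Defs
  imports "HOL-Analysis.Analysis"
begin

definition projected_field ::
  "real^'n^'n \<Rightarrow> real^'n \<Rightarrow> (real^'n) set \<Rightarrow> real \<Rightarrow> real \<Rightarrow> real^'n \<Rightarrow> real^'n" where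
  "projected_field Q q C \<rho> \<eta> u =
     (1 / \<eta>) *\<^sub>R (closest_point C (u - (1 / \<rho>) *\<^sub>R (Q *v u + q)) - u)"

text \<open>The values of \<open>x\<close> at negative times are irrelevant: the derivative is relative to
  \<open>{0..}\<close>, hence one-sided at \<open>0\<close> and two-sided at every \<open>t > 0\<close>. Continuous
  differentiability need not be required separately (see \<open>is_trajectory_C1\<close>).\<close>

definition is_trajectory ::
  "real^'n^'n \<Rightarrow> real^'n \<Rightarrow> (real^'n) set \<Rightarrow> real \<Rightarrow> real \<Rightarrow> real^'n \<Rightarrow> (real \<Rightarrow> real^'n) \<Rightarrow> bool" where
  "is_trajectory Q q C \<rho> \<eta> x0 x \<longleftrightarrow>
     x 0 = x0 \<and>
     (\<forall>t\<ge>0. (x has_vector_derivative projected_field Q q C \<rho> \<eta> (x t)) (at t within {0..}))"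

lemma is_trajectory_C1:
  assumes "is_trajectory Q q C \<rho> \<eta> x0 x" and "closed C" "convex C" "C \<noteq> {}"
  shows "continuous_on {0..} (\<lambda>t. vector_derivative x (at t within {0..}))"
proof -
  have d: "(x has_vector_derivative projected_field Q q C \<rho> \<eta> (x t)) (at t within {0..})"
    if "t \<in> {0..}" for t
    using assms(1) that by (auto simp: is_trajectory_def)
  have x: "continuous_on {0..} x"
    unfolding continuous_on_eq_continuous_within
    by (intro ballI has_vector_derivative_continuous[OF d])
  have cp: "continuous_on UNIV (closest_point C)"
    using assms by (intro continuous_on_closest_point)
  have "continuous_on {0..} (\<lambda>t. Q *v x t)"
    using x by (rule linear_continuous_on_compose) (rule matrix_vector_mul_linear)
  then have "continuous_on {0..} (\<lambda>t. projected_field Q q C \<rho> \<eta> (x t))"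
    unfolding projected_field_def
    by (intro continuous_intros continuous_on_compose2[OF cp] x) auto
  moreover have "vector_derivative x (at t within {0..}) = projected_field Q q C \<rho> \<eta> (x t)"
    if t: "t \<in> {0..}" for t
  proof (rule vector_derivative_within[OF _ d[OF t]])
    have "t islimpt {t..t+1}"
      by (simp)
    then have "t islimpt {0..}"
      by (rule islimpt_subset) (use t in auto)
    then show "at t within {0..} \<noteq> bot"
      by (simp add: trivial_limit_within)
  qed
  ultimately show ?thesis
    by (metis (no_types, lifting) continuous_on_eq)
qed

end

theory Submission
  imports Defs
begin

text \<open>The velocity always points from \<open>x t\<close> to a point \<open>y t\<close> of \<open>C\<close>. If \<open>x T \<notin> C\<close>, separate \<open>x T\<close> from \<open>C\<close> by
  a hyperplane, \<open>a \<bullet> x T < b < a \<bullet> z\<close> for \<open>z \<in> C\<close>. With \<open>k = 1 / \<eta>\<close>, the function \<open>exp (k * t) * (a \<bullet> x t - b)\<close>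
  has derivative \<open>exp (k * t) * k * (a \<bullet> y t - b) \<ge> 0\<close>, yet it is positive at \<open>0\<close> and negative
  at \<open>T\<close>.\<close>

lemma convex_attracted_trajectory_stays:
  fixes x y :: "real \<Rightarrow> 'a::euclidean_space"
  assumes C: "closed C" "convex C" and "x 0 \<in> C" and "k \<ge> 0" and "T \<ge> 0"
    and y: "\<And>t. t \<in> {0..T} \<Longrightarrow> y t \<in> C"
    and deriv: "\<And>t. t \<in> {0..T} \<Longrightarrow>
      (x has_vector_derivative k *\<^sub>R (y t - x t)) (at t within {0..T})"
  shows "x T \<in> C"
proof (rule ccontr)
  assume "x T \<notin> C"
  then obtain a b where xT: "a \<bullet> x T < b" and sep: "\<And>z. z \<in> C \<Longrightarrow> a \<bullet> z > b"
    using separating_hyperplane_closed_point[OF C(2,1)] by blast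
  define f where "f = (\<lambda>t. exp (k * t) * (a \<bullet> x t - b))"
  have f': "(f has_real_derivative exp (k * t) * (k * (a \<bullet> y t - b))) (at t within {0..T})"
    if "t \<in> {0..T}" for t
  proof -
    have "((\<lambda>t. a \<bullet> x t) has_real_derivative a \<bullet> (k *\<^sub>R (y t - x t))) (at t within {0..T})"
      using bounded_linear.has_vector_derivative[OF bounded_linear_inner_right deriv[OF that]]
      by (simp add: has_real_derivative_iff_has_vector_derivative)
    from DERIV_diff[OF this DERIV_const[of b]]
    have ax: "((\<lambda>t. a \<bullet> x t - b) has_real_derivative k * (a \<bullet> y t - a \<bullet> x t))
        (at t within {0..T})"
      by (simp add: inner_diff_right)
    have "((*) k has_real_derivative k) (at t within {0..T})"
      by (rule DERIV_cmult_Id)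
    from DERIV_chain2[OF DERIV_exp this]
    have "((\<lambda>t. exp (k * t)) has_real_derivative exp (k * t) * k) (at t within {0..T})" .
    \<comment> \<open>In the product rule the terms with \<open>a \<bullet> x t\<close> cancel; the
      integrating factor \<open>exp (k * t)\<close> is chosen for this. What remains has a known
      sign, since \<open>y t\<close> lies in \<open>C\<close>.\<close>
    from DERIV_mult[OF this ax] show ?thesis
      unfolding f_def by (rule DERIV_cong) (simp add: algebra_simps)
  qed
  \<comment> \<open>This form of the mean value theorem allows \<open>T = 0\<close> and one-sided
    derivatives at the ends of \<open>{0..T}\<close>.\<close>
  have "\<exists>t\<in>{0..T}. f T - f 0 = exp (k * t) * (k * (a \<bullet> y t - b)) * (T - 0)"
    by (rule mvt_very_simple[OF \<open>T \<ge> 0\<close>])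
      (rule f'[unfolded has_field_derivative_def], simp)
  then obtain t where t: "t \<in> {0..T}"
    "f T - f 0 = exp (k * t) * (k * (a \<bullet> y t - b)) * (T - 0)"
    by (rule bexE)
  have "f T - f 0 \<ge> 0"
    unfolding t(2) using sep[OF y[OF t(1)]] \<open>k \<ge> 0\<close> \<open>T \<ge> 0\<close>
    by (intro mult_nonneg_nonneg) auto
  then have "f 0 \<le> f T"
    by simp
  moreover have "f 0 > 0"
    using sep[OF \<open>x 0 \<in> C\<close>] by (simp add: f_def)
  moreover have "f T < 0"
    using xT by (simp add: f_def mult_pos_neg)
  ultimately show False
    by simp
qed

theorem theorem2p3:
  fixes Q :: "real^'n^'n" and q x0 :: "real^'n" and C :: "(real^'n) set"
    and \<rho> \<eta> :: real and x :: "real \<Rightarrow> real^'n"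
  assumes "transpose Q = Q"
    and "C \<noteq> {}" and "closed C" and "convex C"
    and "x0 \<in> C" and "\<rho> > 0" and "\<eta> > 0"
    and "is_trajectory Q q C \<rho> \<eta> x0 x"
  shows "\<forall>t\<ge>0. x t \<in> C"
proof (intro allI impI)
  fix T :: real
  assume "T \<ge> 0"
  have traj: "x 0 = x0"
    "\<And>t. t \<ge> 0 \<Longrightarrow>
      (x has_vector_derivative projected_field Q q C \<rho> \<eta> (x t)) (at t within {0..})"
    using assms(8) by (auto simp: is_trajectory_def)
  \<comment> \<open>With this moving target in \<open>C\<close> the system reads x' = (1 / \<eta>)
    (y - x), a pull towards \<open>C\<close> at rate 1 / \<eta>.\<close>
  define y where "y = (\<lambda>t. closest_point C (x t - (1 / \<rho>) *\<^sub>R (Q *v x t + q)))"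
  show "x T \<in> C"
  proof (rule convex_attracted_trajectory_stays[where y = y and k = "1 / \<eta>"])
    show "y t \<in> C" for t
      unfolding y_def using \<open>closed C\<close> \<open>C \<noteq> {}\<close> by (rule closest_point_in_set)
    show "(x has_vector_derivative (1 / \<eta>) *\<^sub>R (y t - x t)) (at t within {0..T})"
      if "t \<in> {0..T}" for t
      using has_vector_derivative_within_subset[OF traj(2), of t "{0..T}"] that
      by (auto simp: projected_field_def y_def)
  qed (use assms traj(1) \<open>T \<ge> 0\<close> in auto)
qed

end
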